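(* Let $f:\mathbb{R}^n\to\mathbb{R}\cup\{\infty\}$ be convex and let $X\subset\operatorname{int}(\operatorname{dom} f)$ be closed and convex. Let $X^*=\operatorname{argmin}\{f(x)\mid x\in X\}$ be nonempty and bounded, and let $f^*$ denote the optimal value. Let $\varphi<f^*$, let $0<\lambda_k\le\beta<2$ for all $k$, and let $\sum_{k=0}^\infty\lambda_k=\infty$. Let $(\nu_k)$ be a nonnegative sequence with $\sum_{k=0}^\infty\nu_k<\infty$. Let $(x^k)$, $(h^k)$ and $f_k=f(x^k)$ be generated by the dynamic step size infeasible-point subgradient algorithm (defined in the context), run with target value $\varphi$, parameters $(\lambda_k)$, accuracies $(\varepsilon_k)$ and some $\gamma\in(0,1)$. Let $$L_k=\frac{\lambda_k(2-\beta)(f_k-\varphi)}{\|h^k\|^2}\Big(f^*-f_k+\frac{\beta}{2-\beta}(f^*-\varphi)\Big)$$ and let $$\tilde{\varepsilon}_k=-\left(\frac{\lambda_k(f_k-\varphi)}{\|h^k\|}+d_{X^*}(x^k)\right)+\sqrt{\left(\frac{\lambda_k(f_k-\varphi)}{\|h^k\|}+d_{X^*}(x^k)\right)^2-L_k}.$$ If the subgradients $h^k$ satisfy $0<\underline{H}\le\|h^k\|\le\overline{H}<\infty$ for constants $\underline H,\overline H$, and $(\varepsilon_k)$ satisfies $0\le\varepsilon_k\le\min\{|\tilde{\varepsilon}_k|,\nu_k\}$ for all $k$, then the following holds. (i) For any given $\delta>0$ there exists some $K$ such that $f_K\le f^*+\frac{\beta}{2-\beta}(f^*-\varphi)+\delta$.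 (ii) If additionally $\lambda_k\to0$, then the sequence of objective function values $(f_k)$ of the iterates $(x^k)$ converges to the optimal value $f^*$.
   Context: $\|\cdot\|$ is the Euclidean norm; $d_Y(x)=\inf_{y\in Y}\|x-y\|$; $\operatorname{dom} f=\{x\mid f(x)<\infty\}$; $X$ is strictly contained in $\operatorname{int}(\operatorname{dom} f)$; $\partial f(x)=\{h\mid f(y)\ge f(x)+h^\top(y-x)\ \forall y\in\mathbb{R}^n\}$; $\mathcal{P}_X$ is the Euclidean projection onto $X$. For every $\varepsilon\ge0$, $\mathcal{P}_X^\varepsilon:\mathbb{R}^n\to\mathbb{R}^n$ is a map of which one assumes only $\|\mathcal{P}_X^\varepsilon(x)-\mathcal{P}_X(x)\|\le\varepsilon$ for all $x$. Dynamic step size infeasible-point subgradient algorithm. Input: $\varphi\in\mathbb{R}$, a starting point $x^0$, sequences $(\lambda_k)$, $(\varepsilon_k)$, and $\gamma\in(0,1)$. Initialize $k:=0$, $\ell:=-1$, $x^{-1}:=x^0$, $h^{-1}:=0$, $\alpha_{-1}:=0$, $\varepsilon_{-1}:=\varepsilon_0$. Then repeat: (1) choose $h^k\in\partial f(x^k)$ and set $f_k=f(x^k)$; (2) if $f_k\le\varphi$ or $h^k=0$: if $x^k\in X$, stop; otherwise set $\ell:=\ell+1$, replace $x^k$ by $\mathcal{P}_X^{\varepsilon}(x^{k-1}-\alpha_{k-1}h^{k-1})$ with $\varepsilon=\gamma^{\ell}\varepsilon_{k-1}$, and go back to (1) with the same $k$ (a "refinement phase"); (3) otherwise set $\alpha_k:=\lambda_k(f_k-\varphi)/\|h^k\|^2$,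 $x^{k+1}:=\mathcal{P}_X^{\varepsilon_k}(x^k-\alpha_kh^k)$, $\ell:=0$, $k:=k+1$, and go to (1). No other stopping criterion is used. It is assumed that all points generated lie in $\operatorname{dom} f$ and that subgradients exist there. In all formulas, $x^k,h^k,f_k$ denote the final values for index $k$, after a possible refinement phase at $k$ has ended (for $\varphi<f^*$ the algorithm does not stop in step (2) and every refinement phase is finite, so $(x^k)$ is infinite and $f_k>\varphi$ for all $k$). The conditions on $\|h^k\|$ apply to all subgradients chosen by the algorithm. The absolute value $|\tilde\varepsilon_k|$ is used to avoid conflicting bounds on $\varepsilon_k$ in case $L_k>0$. *)

theory Defs
  imports "HOL-Analysis.Analysis"
begin

text \<open>
  Functions into the reals extended by plus infinity are modelled as functions into \<open>ereal\<close>
  that never take the value \<open>-\<infinity>\<close>.  In \<open>ereal\<close> we have \<open>0 * \<infinity> = 0\<close>, so the end points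
  \<open>u = 0\<close> and \<open>v = 0\<close> below are harmless.
\<close>

definition proper_range :: "('a \<Rightarrow> ereal) \<Rightarrow> bool" where
  "proper_range f \<longleftrightarrow> (\<forall>x. f x \<noteq> -\<infinity>)"

definition convex_fun :: "('a::real_vector \<Rightarrow> ereal) \<Rightarrow> bool" where
  "convex_fun f \<longleftrightarrow>
     (\<forall>x y u v. 0 \<le> u \<longrightarrow> 0 \<le> v \<longrightarrow> u + v = 1 \<longrightarrow>
        f (u *\<^sub>R x + v *\<^sub>R y) \<le> ereal u * f x + ereal v * f y)"

definition eff_dom :: "('a \<Rightarrow> ereal) \<Rightarrow> 'a set" where
  "eff_dom f = {x. f x < \<infinity>}"

definition subdifferential :: "('a::real_inner \<Rightarrow> ereal) \<Rightarrow> 'a \<Rightarrow> 'a set" where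
  "subdifferential f x = {h. \<forall>y. f y \<ge> f x + ereal (h \<bullet> (y - x))}"

definition argmin_on :: "('a \<Rightarrow> ereal) \<Rightarrow> 'a set \<Rightarrow> 'a set" where
  "argmin_on f X = {x. is_arg_min f (\<lambda>y. y \<in> X) x}"

text \<open>
  A state is the data held when a subgradient at the current point is about to be chosen:
  \<open>idx\<close> is \<open>k\<close>, \<open>ell\<close> is the refinement counter, \<open>pt\<close> is the current version of \<open>x\<^sup>k\<close>, and the
  remaining fields are point, subgradient, step size and accuracy with index \<open>k - 1\<close>.
\<close>

record 'a alg_state =
  idx :: nat
  ell :: int
  pt :: 'a
  prev_pt :: 'a
  prev_sg :: 'a
  prev_step :: real
  prev_acc :: real

definition alg_init :: "(nat \<Rightarrow> real) \<Rightarrow> 'a::real_vector \<Rightarrow> 'a alg_state" where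
  "alg_init eps x0 =
     \<lparr>idx = 0, ell = -1, pt = x0, prev_pt = x0, prev_sg = 0, prev_step = 0, prev_acc = eps 0\<rparr>"

text \<open>
  \<open>accepted f \<phi> s h\<close>: with the subgradient \<open>h\<close> chosen in state \<open>s\<close>, the algorithm leaves the
  current index by a regular subgradient step.  The result \<open>None\<close> of \<open>alg_step\<close> means that the
  algorithm stops.
\<close>

definition accepted :: "('a::real_vector \<Rightarrow> ereal) \<Rightarrow> real \<Rightarrow> 'a alg_state \<Rightarrow> 'a \<Rightarrow> bool" where
  "accepted f \<phi> s h \<longleftrightarrow> \<not> (f (pt s) \<le> ereal \<phi> \<or> h = 0)"

definition alg_step ::
  "('a::real_normed_vector \<Rightarrow> ereal) \<Rightarrow> 'a set \<Rightarrow> (real \<Rightarrow> 'a \<Rightarrow> 'a) \<Rightarrow> real \<Rightarrow> (nat \<Rightarrow> real)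
    \<Rightarrow> (nat \<Rightarrow> real) \<Rightarrow> real \<Rightarrow> 'a alg_state \<Rightarrow> 'a \<Rightarrow> 'a alg_state option" where
  "alg_step f X P \<phi> lam eps \<gamma> s h =
     (if \<not> accepted f \<phi> s h then
        (if pt s \<in> X then None
         else Some (s\<lparr>ell := ell s + 1,
                      pt := P (\<gamma> powi (ell s + 1) * prev_acc s)
                              (prev_pt s - prev_step s *\<^sub>R prev_sg s)\<rparr>))
      else
        (let k = idx s;
             \<alpha> = lam k * (real_of_ereal (f (pt s)) - \<phi>) / (norm h)\<^sup>2
         in Some \<lparr>idx = k + 1, ell = 0, pt = P (eps k) (pt s - \<alpha> *\<^sub>R h),
                  prev_pt = pt s, prev_sg = h, prev_step = \<alpha>, prev_acc = eps k\<rparr>))"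

text \<open>
  \<open>S t\<close> is the state after \<open>t\<close> passes (\<open>None\<close> once the algorithm has stopped), and \<open>g t\<close> is the
  subgradient chosen in pass \<open>t\<close>; refinement passes are counted here as well.
\<close>

definition alg_run ::
  "('a::real_inner \<Rightarrow> ereal) \<Rightarrow> 'a set \<Rightarrow> (real \<Rightarrow> 'a \<Rightarrow> 'a) \<Rightarrow> real \<Rightarrow> (nat \<Rightarrow> real)
    \<Rightarrow> (nat \<Rightarrow> real) \<Rightarrow> real \<Rightarrow> 'a \<Rightarrow> (nat \<Rightarrow> 'a) \<Rightarrow> (nat \<Rightarrow> 'a alg_state option) \<Rightarrow> bool" where
  "alg_run f X P \<phi> lam eps \<gamma> x0 g S \<longleftrightarrow>
     S 0 = Some (alg_init eps x0) \<and>
     (\<forall>t. S (Suc t) =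
        (case S t of None \<Rightarrow> None | Some s \<Rightarrow> alg_step f X P \<phi> lam eps \<gamma> s (g t))) \<and>
     (\<forall>t s. S t = Some s \<longrightarrow> pt s \<in> eff_dom f \<and> g t \<in> subdifferential f (pt s))"

text \<open>
  \<open>x k\<close> and \<open>h k\<close> are the final values for index \<open>k\<close>, i.e. those in the (unique) pass that
  performs the regular step from \<open>k\<close> to \<open>k + 1\<close>.  That every index \<open>k\<close> is in fact reached and
  left is not part of the definition; it is a consequence of the assumptions on the data.
\<close>

definition final_iterates ::
  "('a::real_vector \<Rightarrow> ereal) \<Rightarrow> real \<Rightarrow> (nat \<Rightarrow> 'a) \<Rightarrow> (nat \<Rightarrow> 'a alg_state option)
    \<Rightarrow> (nat \<Rightarrow> 'a) \<Rightarrow> (nat \<Rightarrow> 'a) \<Rightarrow> bool" where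
  "final_iterates f \<phi> g S x h \<longleftrightarrow>
     (\<forall>t s. S t = Some s \<and> accepted f \<phi> s (g t) \<longrightarrow> x (idx s) = pt s \<and> h (idx s) = g t)"

end

theory Submission
  imports Defs
begin

text \<open>
  Let \<open>d\<^sub>k\<close> be the distance from \<open>x\<^sup>k\<close> to \<open>X\<^sup>*\<close>.  Nonexpansiveness of the projection and the
  subgradient inequality give \<open>d\<^sub>k\<^sub>+\<^sub>1 \<le> q + \<nu>\<^sub>k\<close> for some
  \<open>q\<^sup>2 \<le> d\<^sub>k\<^sup>2 + \<alpha>\<^sub>k (\<lambda>\<^sub>k (f\<^sub>k - \<phi>) - 2 (f\<^sub>k - f\<^sup>*))\<close>.  If (i) failed, the bracket would stay below a
  negative constant, so \<open>q\<^sup>2 \<le> d\<^sub>k\<^sup>2 - c \<lambda>\<^sub>k\<close> for all \<open>k\<close>; this is impossible, since \<open>\<Sum> \<lambda>\<^sub>k = \<infinity>\<close> while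
  the errors \<open>\<nu>\<^sub>k\<close> are summable.  For (ii), convexity and boundedness of \<open>X\<^sup>*\<close> show that
  points near \<open>X\<close> at distance at least \<open>\<rho>\<close> from \<open>X\<^sup>*\<close> have values bounded away from \<open>f\<^sup>*\<close>, so the same
  decrease occurs whenever \<open>d\<^sub>k \<ge> \<rho>\<close>; hence \<open>d\<^sub>k \<rightarrow> 0\<close>, and \<open>f\<close> is continuous around \<open>X\<^sup>*\<close>.
\<close>

section \<open>Real sequences whose squares decrease up to summable errors\<close>

lemma power2_minus_nonneg_imp_le:
  fixes q d e :: real
  assumes "q\<^sup>2 \<le> d\<^sup>2 - e" "0 \<le> e" "0 \<le> d"
  shows "q \<le> d"
  by (rule power2_le_imp_le) (use assms in linarith)+

text \<open>Summable errors keep \<open>d\<close> bounded, and for bounded \<open>d\<close> a drop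
  of the square by \<open>c * lam k\<close> is a drop of \<open>d\<close> itself by a fixed multiple
  of \<open>lam k\<close>. Summing these drops eventually makes \<open>d\<close> negative.\<close>

lemma square_descent_diverges:
  fixes d lam \<nu> :: "nat \<Rightarrow> real"
  assumes d: "\<And>k. 0 \<le> d k"
    and c: "0 < c"
    and lam: "\<And>k. 0 \<le> lam k"
    and lam_sum: "filterlim (\<lambda>n. \<Sum>k<n. lam k) at_top sequentially"
    and \<nu>: "\<And>k. 0 \<le> \<nu> k" "summable \<nu>"
    and descent: "\<And>k. K \<le> k \<Longrightarrow> \<exists>q\<ge>0. q\<^sup>2 \<le> (d k)\<^sup>2 - c * lam k \<and> d (Suc k) \<le> q + \<nu> k"
  shows False
proof -
  \<comment> \<open>A uniform bound for \<open>d n\<close> with \<open>n \<ge> K\<close>; the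
    summand 1 makes it positive, so that dividing by it is safe.\<close>
  define B where "B = d K + suminf \<nu> + 1"
  have sum_le: "(\<Sum>k\<in>A. \<nu> k) \<le> suminf \<nu>" if "finite A" for A
    using sum_le_suminf[OF \<nu>(2) that] \<nu>(1) by auto
  have nonincr: "q \<le> d k" if "0 \<le> q" "q\<^sup>2 \<le> (d k)\<^sup>2 - c * lam k" for q k
    using power2_minus_nonneg_imp_le[OF that(2)] c lam d by simp
  have bound: "d n \<le> d K + (\<Sum>k=K..<n. \<nu> k)" if "K \<le> n" for n
    using that
  proof (induction n rule: dec_induct)
    case (step n)
    then obtain q where "0 \<le> q" "q\<^sup>2 \<le> (d n)\<^sup>2 - c * lam n" "d (Suc n) \<le> q + \<nu> n"
      using descent by blast
    with nonincr step show ?case by fastforce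
  qed simp
  have dB: "d n \<le> B" if "K \<le> n" for n
    using bound[OF that] sum_le[of "{K..<n}"] by (simp add: B_def)
  have B: "0 < B"
    using d[of K] sum_le[of "{}"] by (simp add: B_def)
  \<comment> \<open>From \<open>d\<^sup>2 - q\<^sup>2 = (d - q) * (d + q)\<close> and
    \<open>d + q \<le> 2 * B\<close>.\<close>
  define C where "C = c / (2 * B)"
  have C: "0 < C" using B c by (simp add: C_def)
  have telescope: "d n + C * (\<Sum>k<n. lam k) \<le> d K + C * (\<Sum>k<K. lam k) + (\<Sum>k=K..<n. \<nu> k)"
    if "K \<le> n" for n
    using that
  proof (induction n rule: dec_induct)
    case (step n)
    then obtain q where q: "0 \<le> q" "q\<^sup>2 \<le> (d n)\<^sup>2 - c * lam n" "d (Suc n) \<le> q + \<nu> n"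
      using descent by blast
    have "c * lam n \<le> (d n - q) * (d n + q)"
      using q(2) by (simp add: power2_eq_square algebra_simps)
    also have "\<dots> \<le> (d n - q) * (2 * B)"
      using nonincr[OF q(1,2)] dB[OF step(1)] by (intro mult_left_mono) auto
    finally have "C * lam n \<le> d n - q"
      using B by (simp add: C_def field_simps)
    with q(3) step show ?case by (simp add: algebra_simps)
  qed simp
  \<comment> \<open>Once the partial sums of \<open>lam\<close> exceed this threshold,
    \<open>telescope\<close> forces \<open>d n < 0\<close>.\<close>
  define M where "M = (B + C * (\<Sum>k<K. lam k)) / C"
  have "\<forall>\<^sub>F n in sequentially. M < (\<Sum>k<n. lam k) \<and> K \<le> n"
    using lam_sum by (auto simp: filterlim_at_top_dense eventually_conj_iff)
  then obtain n where n: "M < (\<Sum>k<n. lam k)" "K \<le> n"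
    using eventually_happens by fastforce
  have "B + C * (\<Sum>k<K. lam k) < C * (\<Sum>k<n. lam k)"
    using n(1) C by (simp add: M_def field_simps)
  with telescope[OF n(2)] d[of n] sum_le[of "{K..<n}"] show False
    by (simp add: B_def)
qed

text \<open>By the previous lemma \<open>d\<close> enters the region below \<open>\<rho>\<close>
  after any given index. From there a step overshoots to at most \<open>2 * \<rho>\<close> plus an
  error, and outside the region \<open>d\<close> grows only by the errors, whose tail is below
  \<open>\<rho>\<close>.\<close>

lemma square_descent_tendsto_zero:
  fixes d lam \<nu> :: "nat \<Rightarrow> real"
  assumes d: "\<And>k. 0 \<le> d k"
    and lam: "\<And>k. 0 \<le> lam k"
    and lam_sum: "filterlim (\<lambda>n. \<Sum>k<n. lam k) at_top sequentially"
    and \<nu>: "\<And>k. 0 \<le> \<nu> k" "summable \<nu>"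
    and far: "\<And>\<rho>. 0 < \<rho> \<Longrightarrow> \<exists>c>0. \<forall>\<^sub>F k in sequentially. \<rho> \<le> d k \<longrightarrow>
                (\<exists>q\<ge>0. q\<^sup>2 \<le> (d k)\<^sup>2 - c * lam k \<and> d (Suc k) \<le> q + \<nu> k)"
    and near: "\<And>\<rho>. 0 < \<rho> \<Longrightarrow> \<forall>\<^sub>F k in sequentially. d k < \<rho> \<longrightarrow> d (Suc k) \<le> 2 * \<rho> + \<nu> k"
  shows "d \<longlonglongrightarrow> 0"
proof (rule LIMSEQ_I)
  fix r :: real assume "0 < r"
  \<comment> \<open>Two thirds of \<open>r\<close> pay for the overshoot, one third for the tail of
    \<open>\<nu>\<close>.\<close>
  define \<rho> where "\<rho> = r / 3"
  have \<rho>: "0 < \<rho>" using \<open>0 < r\<close> by (simp add: \<rho>_def)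
  from far[OF \<rho>] obtain c K1 where c: "0 < c" and K1: "\<And>k. K1 \<le> k \<Longrightarrow> \<rho> \<le> d k \<Longrightarrow>
      \<exists>q\<ge>0. q\<^sup>2 \<le> (d k)\<^sup>2 - c * lam k \<and> d (Suc k) \<le> q + \<nu> k"
    unfolding eventually_sequentially by blast
  from near[OF \<rho>] obtain K2 where K2: "\<And>k. K2 \<le> k \<Longrightarrow> d k < \<rho> \<Longrightarrow> d (Suc k) \<le> 2 * \<rho> + \<nu> k"
    unfolding eventually_sequentially by blast
  from \<nu>(2) \<rho> obtain K3 where K3: "\<And>m n. K3 \<le> m \<Longrightarrow> norm (sum \<nu> {m..<n}) < \<rho>"
    unfolding summable_Cauchy by blast
  define K where "K = Max {K1, K2, K3}"
  have K: "K1 \<le> K" "K2 \<le> K" "K3 \<le> K" by (auto simp: K_def)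
  have "\<exists>m\<ge>K. d m < \<rho>"
  proof (rule ccontr)
    assume "\<not> (\<exists>m\<ge>K. d m < \<rho>)"
    then have "\<exists>q\<ge>0. q\<^sup>2 \<le> (d k)\<^sup>2 - c * lam k \<and> d (Suc k) \<le> q + \<nu> k" if "K \<le> k" for k
      using that K by (intro K1) auto
    then show False by (rule square_descent_diverges[OF d c lam lam_sum \<nu>])
  qed
  then obtain m where m: "K \<le> m" "d m < \<rho>" by blast
  have "d n \<le> 2 * \<rho> + (\<Sum>k=m..<n. \<nu> k)" if "m \<le> n" for n
    using that
  proof (induction n rule: dec_induct)
    case base
    then show ?case using m(2) \<rho> by simp
  next
    case (step n)
    show ?case
    proof (cases "d n < \<rho>")
      case True
      have "d (Suc n) \<le> 2 * \<rho> + \<nu> n"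
        using K2[OF _ True] step(1) m K by linarith
      moreover have "0 \<le> (\<Sum>k=m..<n. \<nu> k)"
        by (simp add: sum_nonneg \<nu>)
      ultimately show ?thesis using step(1) by simp
    next
      case False
      then obtain q where q: "0 \<le> q" "q\<^sup>2 \<le> (d n)\<^sup>2 - c * lam n" "d (Suc n) \<le> q + \<nu> n"
        using K1[of n] step(1) m K by force
      have "q \<le> d n"
        using power2_minus_nonneg_imp_le[OF q(2)] c lam d by simp
      with q(3) step show ?thesis by simp
    qed
  qed
  then have "norm (d n - 0) < r" if "m \<le> n" for n
    using that K3[of m n] m K d[of n] by (force simp: \<rho>_def)
  then show "\<exists>no. \<forall>n\<ge>no. norm (d n - 0) < r" by blast
qed

section \<open>Convex geometry: growth away from the solution set, convergence of values, a single
  subgradient step\<close>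

text \<open>
  A violating point may lie far from \<open>M\<close>; it is pulled back along the segment to its nearest point of
  \<open>M\<close> until its distance is exactly \<open>\<rho>\<close>, which makes compactness available.
\<close>

lemma sharp_growth:
  fixes r :: "'a::euclidean_space \<Rightarrow> real"
  assumes conv: "convex_on D r"
    and X: "closed X" "convex X" "X \<subseteq> interior D"
    and M_def: "M = {x \<in> X. r x \<le> v}"
    and M: "M \<noteq> {}" "bounded M"
    and \<rho>: "0 < \<rho>"
  shows "\<exists>\<eta>>0. \<forall>w\<in>D. \<rho> \<le> infdist w M \<longrightarrow> infdist w X < \<eta> \<longrightarrow> v + \<eta> \<le> r w"
proof (rule ccontr)
  assume neg: "\<not> ?thesis"
  have D: "convex D" using conv by (simp add: convex_on_def)
  have cont: "continuous_on (interior D) r"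
    using convex_on_subset[OF conv interior_subset convex_interior[OF D]]
    by (intro convex_on_continuous) auto
  have "closed M"
    using continuous_closed_preimage[OF continuous_on_subset[OF cont X(3)] X(1) closed_atMost, of v]
    by (simp add: M_def vimage_def Int_def)
  then have cM: "compact M" using M compact_eq_bounded_closed by blast
  have Xne: "X \<noteq> {}" using M by (auto simp: M_def)
  have "\<exists>u. infdist u M = \<rho> \<and> infdist u X \<le> inverse (real (Suc j)) \<and> u \<in> D
           \<and> r u \<le> v + inverse (real (Suc j))" for j
  proof -
    define \<eta> where "\<eta> = inverse (real (Suc j))"
    have "0 < \<eta>" by (simp add: \<eta>_def)
    with neg obtain w where w: "w \<in> D" "\<rho> \<le> infdist w M" "infdist w X < \<eta>" "r w < v + \<eta>"
      by (meson not_le)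
    obtain p where p: "p \<in> M" "infdist w M = dist w p"
      using infdist_attains_inf[OF \<open>closed M\<close> M(1)] by blast
    obtain q where q: "q \<in> X" "infdist w X = dist w q"
      using infdist_attains_inf[OF X(1) Xne] by blast
    define t where "t = \<rho> / infdist w M"
    have t: "0 < t" "t \<le> 1" using w(2) \<rho> by (auto simp: t_def)
    define u where "u = (1 - t) *\<^sub>R p + t *\<^sub>R w"
    have pX: "p \<in> X" "r p \<le> v" "p \<in> D" using p(1) X(3) interior_subset by (auto simp: M_def)
    have uD: "u \<in> D" using D pX(3) w(1) t unfolding u_def by (auto simp: convex_alt)
    have "r u \<le> (1 - t) * r p + t * r w"
      using conv pX(3) w(1) t unfolding u_def by (auto intro!: convex_onD)
    also have "\<dots> \<le> (1 - t) * v + t * (v + \<eta>)"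
      using pX(2) w(4) t by (intro add_mono mult_left_mono) auto
    also have "\<dots> \<le> v + \<eta>" using t \<open>0 < \<eta>\<close> by (simp add: algebra_simps)
    finally have ru: "r u \<le> v + \<eta>" .
    \<comment> \<open>Moving the nearest feasible point \<open>q\<close> towards \<open>p\<close> by
      the same ratio gives a feasible point whose distance to \<open>u\<close> is \<open>t\<close>
      times that of \<open>q\<close> to \<open>w\<close>; pulling back thus keeps the point near
      \<open>X\<close>.\<close>
    have "(1 - t) *\<^sub>R p + t *\<^sub>R q \<in> X" using X(2) pX(1) q(1) t by (auto simp: convex_alt)
    then have "infdist u X \<le> dist u ((1 - t) *\<^sub>R p + t *\<^sub>R q)" by (rule infdist_le)
    also have "\<dots> = t * dist w q"
      using t by (simp add: u_def dist_norm flip: scaleR_diff_right)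
    also have "\<dots> \<le> 1 * dist w q" using t by (intro mult_right_mono) auto
    finally have uX: "infdist u X \<le> \<eta>" using q(2) w(3) by simp
    have "dist u p = t * dist w p"
    proof -
      have "u - p = t *\<^sub>R (w - p)" by (simp add: u_def algebra_simps)
      then show ?thesis using t by (simp add: dist_norm)
    qed
    then have up: "dist u p = \<rho>"
      using p(2) w(2) \<rho> by (cases "w = p") (auto simp: t_def)
    \<comment> \<open>The path from \<open>w\<close> to \<open>u\<close> uses up only
      \<open>infdist w M - \<rho>\<close>, so no other point of \<open>M\<close> can be closer to
      \<open>u\<close> than \<open>\<rho>\<close>.\<close>
    have "dist w u = (1 - t) * dist w p"
    proof -
      have "w - u = (1 - t) *\<^sub>R (w - p)" by (simp add: u_def algebra_simps)
      then show ?thesis using t by (simp add: dist_norm)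
    qed
    also have "\<dots> = infdist w M - \<rho>"
      using p(2) w(2) \<rho> by (cases "w = p") (auto simp: t_def algebra_simps)
    finally have "\<rho> \<le> infdist u M"
      using infdist_triangle[of w M u] by simp
    moreover have "infdist u M \<le> \<rho>" using infdist_le[OF p(1), of u] up by simp
    ultimately show ?thesis using uD ru uX unfolding \<eta>_def by (intro exI[of _ u]) auto
  qed
  then obtain u where u: "\<And>j. infdist (u j) M = \<rho>" "\<And>j. infdist (u j) X \<le> inverse (real (Suc j))"
     "\<And>j. u j \<in> D" "\<And>j. r (u j) \<le> v + inverse (real (Suc j))" by metis
  \<comment> \<open>A limit point \<open>l\<close> lies in \<open>X\<close> since the distances to
    \<open>X\<close> vanish, and continuity gives \<open>r l \<le> v\<close>. So \<open>l\<close> is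
    in \<open>M\<close>, although every \<open>u j\<close> has distance \<open>\<rho>\<close> from
    \<open>M\<close>.\<close>
  have "compact {x. infdist x M \<le> \<rho>}" using compact_infdist_le[OF M(1) cM \<rho>] .
  moreover have "\<forall>j. u j \<in> {x. infdist x M \<le> \<rho>}" using u(1) by simp
  ultimately obtain l s where l: "strict_mono s" "(u \<circ> s) \<longlonglongrightarrow> l"
    unfolding compact_def by metis
  have inv0: "(\<lambda>j. inverse (real (Suc (s j)))) \<longlonglongrightarrow> 0"
    using LIMSEQ_subseq_LIMSEQ[OF LIMSEQ_inverse_real_of_nat l(1)] by (simp add: o_def)
  have "(\<lambda>j. infdist ((u \<circ> s) j) X) \<longlonglongrightarrow> infdist l X" using l(2) by (rule tendsto_infdist)
  then have "infdist l X \<le> 0" using u(2) by (intro LIMSEQ_le[OF _ inv0]) auto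
  then have lX: "l \<in> X"
    using X(1) Xne in_closed_iff_infdist_zero[of X l] infdist_nonneg[of l X] by auto
  then have "isCont r l"
    using cont X(3) continuous_on_eq_continuous_at[OF open_interior] by blast
  then have "(\<lambda>j. r ((u \<circ> s) j)) \<longlonglongrightarrow> r l" using l(2) by (rule isCont_tendsto_compose)
  moreover have "(\<lambda>j. v + inverse (real (Suc (s j)))) \<longlonglongrightarrow> v + 0"
    using inv0 by (intro tendsto_intros)
  ultimately have "r l \<le> v + 0" using u(4) by (intro LIMSEQ_le) auto
  with lX have "infdist l M = 0" by (simp add: M_def)
  moreover have "(\<lambda>j. infdist ((u \<circ> s) j) M) \<longlonglongrightarrow> infdist l M" using l(2) by (rule tendsto_infdist)
  ultimately show False using u(1) \<rho> by (simp add: o_def LIMSEQ_const_iff)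
qed

text \<open>The sequence \<open>x\<close> itself need not converge. Uniform continuity on a compact
  neighbourhood of \<open>M\<close> allows comparing each \<open>x k\<close> with its own nearest
  point of \<open>M\<close>.\<close>

lemma tendsto_of_infdist_compact:
  fixes r :: "'a::euclidean_space \<Rightarrow> real"
  assumes cont: "continuous_on U r" and U: "open U"
    and M: "compact M" "M \<noteq> {}" "M \<subseteq> U" "\<And>p. p \<in> M \<Longrightarrow> r p = v"
    and lim: "(\<lambda>k. infdist (x k) M) \<longlonglongrightarrow> 0"
  shows "(\<lambda>k. r (x k)) \<longlonglongrightarrow> v"
proof -
  obtain e where e: "0 < e" "{x. infdist x M \<le> e} \<subseteq> U"
    using compact_in_open_separated[OF M(2,1) U M(3)] by blast
  let ?N = "{x. infdist x M \<le> e}"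
  have "uniformly_continuous_on ?N r"
    using compact_uniformly_continuous[OF continuous_on_subset[OF cont e(2)]
        compact_infdist_le[OF M(2,1) e(1)]] .
  show ?thesis
  proof (rule tendstoI)
    fix \<epsilon> :: real assume "0 < \<epsilon>"
    with \<open>uniformly_continuous_on ?N r\<close> obtain \<delta> where \<delta>: "0 < \<delta>"
      "\<And>y z. y \<in> ?N \<Longrightarrow> z \<in> ?N \<Longrightarrow> dist z y < \<delta> \<Longrightarrow> dist (r z) (r y) < \<epsilon>"
      unfolding uniformly_continuous_on_def by metis
    have "\<forall>\<^sub>F k in sequentially. infdist (x k) M < min e \<delta>"
      using lim \<delta>(1) e(1) by (intro order_tendstoD(2)) auto
    then show "\<forall>\<^sub>F k in sequentially. dist (r (x k)) v < \<epsilon>"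
    proof eventually_elim
      case (elim k)
      obtain p where p: "p \<in> M" "infdist (x k) M = dist (x k) p"
        using infdist_attains_inf[OF compact_imp_closed[OF M(1)] M(2)] by blast
      have "dist (r (x k)) (r p) < \<epsilon>"
        using elim p e(1) by (intro \<delta>(2)) auto
      with M(4)[OF p(1)] show ?case by simp
    qed
  qed
qed

text \<open>Here \<open>q\<close> is the distance of the exact projection to \<open>p\<close>; the
  projection error is added only afterwards, so it enters linearly and not inside the square. The
  quadratic bound serves far from the solutions, the bound by the step length near them.\<close>

lemma projected_subgradient_step:
  fixes X :: "'a::euclidean_space set"
  assumes X: "closed X" "convex X"
    and p: "p \<in> X"
    and sg: "r + h \<bullet> (p - x) \<le> v"
    and h: "h \<noteq> 0" and lam: "0 \<le> lam" and pos: "\<phi> \<le> r"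
    and \<alpha>: "\<alpha> = lam * (r - \<phi>) / (norm h)\<^sup>2"
    and x': "norm (x' - closest_point X (x - \<alpha> *\<^sub>R h)) \<le> e"
  obtains q where "0 \<le> q" "q\<^sup>2 \<le> (dist x p)\<^sup>2 + \<alpha> * (lam * (r - \<phi>) - 2 * (r - v))"
    "q \<le> dist x p + lam * (r - \<phi>) / norm h" "dist x' p \<le> q + e"
proof
  let ?q = "dist (closest_point X (x - \<alpha> *\<^sub>R h)) p"
  have \<alpha>0: "0 \<le> \<alpha>" using lam pos by (simp add: \<alpha>)
  have "?q = dist (closest_point X (x - \<alpha> *\<^sub>R h)) (closest_point X p)"
    using p by (simp add: closest_point_self)
  also have "\<dots> \<le> dist (x - \<alpha> *\<^sub>R h) p"
    using X p by (intro closest_point_lipschitz) auto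
  finally have q: "?q \<le> dist (x - \<alpha> *\<^sub>R h) p" .
  have "?q\<^sup>2 \<le> (norm ((x - p) - \<alpha> *\<^sub>R h))\<^sup>2"
    using q by (intro power_mono) (auto simp: dist_norm algebra_simps)
  also have "\<dots> = (dist x p)\<^sup>2 + 2 * \<alpha> * (h \<bullet> (p - x)) + \<alpha> * (\<alpha> * (norm h)\<^sup>2)"
    unfolding dist_norm power2_norm_eq_inner
    by (simp add: inner_commute algebra_simps)
  also have "\<alpha> * (norm h)\<^sup>2 = lam * (r - \<phi>)" using h by (simp add: \<alpha>)
  also have "2 * \<alpha> * (h \<bullet> (p - x)) \<le> 2 * \<alpha> * (v - r)"
    using sg \<alpha>0 by (intro mult_left_mono) auto
  finally show "?q\<^sup>2 \<le> (dist x p)\<^sup>2 + \<alpha> * (lam * (r - \<phi>) - 2 * (r - v))"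
    by (simp add: algebra_simps)
  have "dist (x - \<alpha> *\<^sub>R h) p \<le> dist x p + norm (\<alpha> *\<^sub>R h)"
    unfolding dist_norm using norm_triangle_ineq4[of "x - p" "\<alpha> *\<^sub>R h"]
    by (simp add: algebra_simps)
  also have "norm (\<alpha> *\<^sub>R h) = lam * (r - \<phi>) / norm h"
    using lam pos h by (simp add: \<alpha> power2_eq_square abs_mult)
  finally show "?q \<le> dist x p + lam * (r - \<phi>) / norm h" using q by simp
  show "dist x' p \<le> ?q + e"
    using x' dist_triangle[of x' p "closest_point X (x - \<alpha> *\<^sub>R h)"]
    by (simp add: dist_norm)
qed simp

section \<open>From extended-real to real-valued convexity\<close>

lemma convex_eff_dom:
  assumes "convex_fun f"
  shows "convex (eff_dom f)"
proof (rule convexI)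
  fix x y and u v :: real
  assume xy: "x \<in> eff_dom f" "y \<in> eff_dom f" and uv: "0 \<le> u" "0 \<le> v" "u + v = 1"
  have "ereal a * f z < \<infinity>" if "0 \<le> a" "z \<in> eff_dom f" for a z
    using that by (cases "f z"; cases "a = 0") (auto simp: eff_dom_def zero_ereal_def)
  then have "ereal u * f x + ereal v * f y < \<infinity>"
    using xy uv by simp
  moreover have "f (u *\<^sub>R x + v *\<^sub>R y) \<le> ereal u * f x + ereal v * f y"
    using assms uv unfolding convex_fun_def by blast
  ultimately show "u *\<^sub>R x + v *\<^sub>R y \<in> eff_dom f"
    unfolding eff_dom_def by (auto intro: le_less_trans)
qed

text \<open>\<open>real_of_ereal\<close> sends infinity to 0, so convexity is claimed on the
  effective domain only.\<close>

lemma convex_on_real_of_ereal: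
  assumes "proper_range f" "convex_fun f"
  shows "convex_on (eff_dom f) (\<lambda>x. real_of_ereal (f x))"
proof (rule convex_onI)
  show "convex (eff_dom f)" using assms by (intro convex_eff_dom)
  fix t x y assume t: "0 < t" "t < (1::real)" and xy: "x \<in> eff_dom f" "y \<in> eff_dom f"
  have fin: "\<exists>a. f z = ereal a" if "z \<in> eff_dom f" for z
    using that assms(1) unfolding eff_dom_def proper_range_def
    by (cases "f z") auto
  have "(1 - t) *\<^sub>R x + t *\<^sub>R y \<in> eff_dom f"
    using convex_eff_dom[OF assms(2)] xy t by (auto simp: convex_alt)
  moreover have "f ((1 - t) *\<^sub>R x + t *\<^sub>R y) \<le> ereal (1 - t) * f x + ereal t * f y"
    using assms(2) t unfolding convex_fun_def by simp
  ultimately show "real_of_ereal (f ((1 - t) *\<^sub>R x + t *\<^sub>R y))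
      \<le> (1 - t) * real_of_ereal (f x) + t * real_of_ereal (f y)"
    using fin[of x] fin[of y] fin[of "(1 - t) *\<^sub>R x + t *\<^sub>R y"] xy by auto
qed

section \<open>Runs of the algorithm: no stopping, finite refinement, accuracy of the
  iterates\<close>

locale subgradient_run =
  fixes f :: "'a::euclidean_space \<Rightarrow> ereal"
    and X :: "'a set"
    and P :: "real \<Rightarrow> 'a \<Rightarrow> 'a"
    and \<phi> \<gamma> :: real
    and lam eps :: "nat \<Rightarrow> real"
    and x0 :: 'a
    and g x h :: "nat \<Rightarrow> 'a"
    and S :: "nat \<Rightarrow> 'a alg_state option"
  assumes f_range: "proper_range f"
    and f_convex: "convex_fun f"
    and X_dom: "X \<subseteq> interior (eff_dom f)"
    and X: "closed X" "convex X" "X \<noteq> {}"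
    and approx_proj: "0 \<le> e \<Longrightarrow> norm (P e y - closest_point X y) \<le> e"
    and target: "y \<in> X \<Longrightarrow> ereal \<phi> < f y"
    and eps_nonneg: "0 \<le> eps k"
    and \<gamma>: "0 < \<gamma>" "\<gamma> < 1"
    and run: "alg_run f X P \<phi> lam eps \<gamma> x0 g S"
    and iterates: "final_iterates f \<phi> g S x h"
    and g_nonzero: "S t = Some s \<Longrightarrow> g t \<noteq> 0"
begin

abbreviation r :: "'a \<Rightarrow> real" where "r y \<equiv> real_of_ereal (f y)"

abbreviation step_size :: "nat \<Rightarrow> real" where
  "step_size k \<equiv> lam k * (r (x k) - \<phi>) / (norm (h k))\<^sup>2"

abbreviation sg_step :: "nat \<Rightarrow> 'a" where
  "sg_step k \<equiv> x k - step_size k *\<^sub>R h k"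

lemma ereal_r: "y \<in> eff_dom f \<Longrightarrow> f y = ereal (r y)"
  using f_range unfolding eff_dom_def proper_range_def by (cases "f y") auto

lemma X_subset_eff_dom: "X \<subseteq> eff_dom f"
  using X_dom interior_subset by blast

lemma continuous_on_r: "continuous_on (interior (eff_dom f)) r"
proof -
  have "convex_on (interior (eff_dom f)) r"
    using convex_on_subset[OF convex_on_real_of_ereal interior_subset]
      convex_interior convex_eff_dom f_range f_convex by blast
  then show ?thesis by (intro convex_on_continuous) auto
qed

lemma run_init: "S 0 = Some (alg_init eps x0)"
  and run_Suc: "S t = Some s \<Longrightarrow> S (Suc t) = alg_step f X P \<phi> lam eps \<gamma> s (g t)"
  and run_dom: "S t = Some s \<Longrightarrow> pt s \<in> eff_dom f"
  and run_subgradient: "S t = Some s \<Longrightarrow> g t \<in> subdifferential f (pt s)"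
  using run unfolding alg_run_def by auto

lemma accepted_iterate:
  assumes "S t = Some s" "accepted f \<phi> s (g t)"
  shows "x (idx s) = pt s" "h (idx s) = g t"
  using assms iterates unfolding final_iterates_def by blast+

lemma run_Suc_accepted:
  assumes "S t = Some s" "accepted f \<phi> s (g t)"
  shows "S (Suc t) = Some \<lparr>idx = Suc (idx s), ell = 0, pt = P (eps (idx s)) (sg_step (idx s)),
           prev_pt = x (idx s), prev_sg = h (idx s), prev_step = step_size (idx s),
           prev_acc = eps (idx s)\<rparr>"
  using run_Suc[OF assms(1)] assms(2) accepted_iterate[OF assms]
  by (simp add: alg_step_def Let_def)

text \<open>As chosen subgradients are nonzero, rejection can only be due to a value at most
  \<open>\<phi>\<close>. All values on \<open>X\<close> exceed \<open>\<phi>\<close>, hence the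
  point is infeasible and the run does not stop.\<close>

lemma run_Suc_rejected:
  assumes "S t = Some s" "\<not> accepted f \<phi> s (g t)"
  shows "r (pt s) \<le> \<phi>"
    and "S (Suc t) = Some (s\<lparr>ell := ell s + 1,
           pt := P (\<gamma> powi (ell s + 1) * prev_acc s) (prev_pt s - prev_step s *\<^sub>R prev_sg s)\<rparr>)"
proof -
  have le: "f (pt s) \<le> ereal \<phi>"
    using assms g_nonzero by (auto simp: accepted_def)
  then show "r (pt s) \<le> \<phi>" using ereal_r[OF run_dom[OF assms(1)]] by (metis ereal_less_eq(3))
  have "pt s \<notin> X" using le target[of "pt s"] by auto
  then show "S (Suc t) = Some (s\<lparr>ell := ell s + 1,
           pt := P (\<gamma> powi (ell s + 1) * prev_acc s) (prev_pt s - prev_step s *\<^sub>R prev_sg s)\<rparr>)"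
    using run_Suc[OF assms(1)] assms(2) by (simp add: alg_step_def)
qed

text \<open>Refinement at index \<open>Suc k\<close> projects the same point
  \<open>sg_step k\<close> again, with accuracy \<open>eps k\<close> times a power of
  \<open>\<gamma>\<close> that is at most 1, so the error bound of the regular step survives. The
  clause is restricted to \<open>idx s = Suc k\<close> because the initial state has no
  predecessor.\<close>

lemma run_invariant:
  assumes "S t = Some s"
  shows "0 \<le> prev_acc s \<and> -1 \<le> ell s \<and>
    (\<forall>k. idx s = Suc k \<longrightarrow> 0 \<le> ell s \<and> prev_acc s = eps k
       \<and> prev_pt s - prev_step s *\<^sub>R prev_sg s = sg_step k
       \<and> norm (pt s - closest_point X (sg_step k)) \<le> eps k)"
  using assms
proof (induction t arbitrary: s)
  case 0
  then show ?case using run_init eps_nonneg by (auto simp: alg_init_def)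
next
  case (Suc t)
  obtain s0 where s0: "S t = Some s0"
    using Suc.prems run unfolding alg_run_def by (cases "S t") auto
  note IH = Suc.IH[OF s0]
  show ?case
  proof (cases "accepted f \<phi> s0 (g t)")
    case True
    then show ?thesis
      using run_Suc_accepted[OF s0 True] Suc.prems eps_nonneg approx_proj by auto
  next
    case False
    have "norm (P (\<gamma> powi (ell s0 + 1) * eps k) y - closest_point X y) \<le> eps k"
      if "0 \<le> ell s0" for k y
    proof -
      have "\<gamma> powi (ell s0 + 1) \<le> 1"
        using that \<gamma> by (intro power_int_le_one) auto
      moreover have "0 \<le> \<gamma> powi (ell s0 + 1)"
        using \<gamma> by simp
      ultimately show ?thesis
        using approx_proj[of "\<gamma> powi (ell s0 + 1) * eps k" y] eps_nonneg[of k]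
        by (smt (verit) mult_left_le_one_le mult_nonneg_nonneg)
    qed
    then show ?thesis
      using run_Suc_rejected(2)[OF s0 False] Suc.prems IH by auto
  qed
qed

text \<open>
  Endless refinement would drive the current point to a point of \<open>X\<close>, where \<open>f\<close> is continuous and
  exceeds \<open>\<phi>\<close>.
\<close>

lemma refinement_terminates:
  assumes s: "S t = Some s"
  shows "\<exists>t' s'. S t' = Some s' \<and> idx s' = idx s \<and> accepted f \<phi> s' (g t')"
proof (rule ccontr)
  assume "\<not> ?thesis"
  then have rejected: "\<not> accepted f \<phi> s' (g t')" if "S t' = Some s'" "idx s' = idx s" for t' s'
    using that by blast
  define y where "y = prev_pt s - prev_step s *\<^sub>R prev_sg s"
  \<comment> \<open>The accuracy used in the pass from \<open>S (t + n)\<close> to its successor;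
    the added 1 reflects that \<open>ell\<close> is increased before projecting.\<close>
  define e where "e n = \<gamma> powi (ell s + 1 + int n) * prev_acc s" for n
  have states: "\<exists>s'. S (t + n) = Some s' \<and> idx s' = idx s \<and> ell s' = ell s + int n
      \<and> prev_pt s' - prev_step s' *\<^sub>R prev_sg s' = y \<and> prev_acc s' = prev_acc s" for n
  proof (induction n)
    case 0
    then show ?case using s by (simp add: y_def)
  next
    case (Suc n)
    then obtain s' where s': "S (t + n) = Some s'" "idx s' = idx s" "ell s' = ell s + int n"
       "prev_pt s' - prev_step s' *\<^sub>R prev_sg s' = y" "prev_acc s' = prev_acc s" by blast
    show ?case using run_Suc_rejected(2)[OF s'(1) rejected[OF s'(1,2)]] s' by auto
  qed
  \<comment> \<open>Each refined point is rejected in turn, so its value stays at most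
    \<open>\<phi>\<close>.\<close>
  have u: "P (e n) y \<in> eff_dom f \<and> r (P (e n) y) \<le> \<phi>" for n
  proof -
    obtain s' where s': "S (t + n) = Some s'" "idx s' = idx s" "ell s' = ell s + int n"
       "prev_pt s' - prev_step s' *\<^sub>R prev_sg s' = y" "prev_acc s' = prev_acc s"
      using states by blast
    obtain s'' where s'': "S (Suc (t + n)) = Some s''" "idx s'' = idx s" "pt s'' = P (e n) y"
      using run_Suc_rejected(2)[OF s'(1) rejected[OF s'(1,2)]] s'
      by (simp add: e_def algebra_simps)
    then show ?thesis
      using run_dom run_Suc_rejected(1)[OF s''(1) rejected[OF s''(1,2)]] by metis
  qed
  have e_eq: "e n = (\<gamma> powi (ell s + 1) * prev_acc s) * \<gamma> ^ n" for n
    using \<gamma> by (simp add: e_def power_int_add)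
  have e0: "0 \<le> e n" for n
    using run_invariant[OF s] \<gamma> by (simp add: e_def)
  have "e \<longlonglongrightarrow> 0"
  proof -
    have "(\<lambda>n. (\<gamma> powi (ell s + 1) * prev_acc s) * \<gamma> ^ n) \<longlonglongrightarrow> (\<gamma> powi (ell s + 1) * prev_acc s) * 0"
      using \<gamma> by (intro tendsto_intros LIMSEQ_power_zero) auto
    then show ?thesis by (simp add: e_eq[abs_def])
  qed
  then have "(\<lambda>n. P (e n) y - closest_point X y) \<longlonglongrightarrow> 0"
    by (rule Lim_null_comparison[rotated]) (simp add: approx_proj[OF e0])
  then have lim: "(\<lambda>n. P (e n) y) \<longlonglongrightarrow> closest_point X y"
    by (simp add: LIM_zero_iff)
  have cpX: "closest_point X y \<in> X" using X by (intro closest_point_in_set)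
  then have "isCont r (closest_point X y)"
    using continuous_on_r X_dom continuous_on_eq_continuous_at[OF open_interior] by blast
  then have "(\<lambda>n. r (P (e n) y)) \<longlonglongrightarrow> r (closest_point X y)"
    using lim by (rule isCont_tendsto_compose)
  then have "r (closest_point X y) \<le> \<phi>"
    using u by (intro LIMSEQ_le_const2) auto
  then show False
    using target[OF cpX] ereal_r[of "closest_point X y"] cpX X_subset_eff_dom
    by (metis ereal_less_eq(3) not_le subsetD)
qed

text \<open>\<open>final_iterates\<close> constrains \<open>x k\<close> and \<open>h k\<close> only
  through an accepted pass with index \<open>k\<close>; this provides one for every
  \<open>k\<close>.\<close>

lemma index_accepted: "\<exists>t s. S t = Some s \<and> idx s = k \<and> accepted f \<phi> s (g t)"
proof (induction k)
  case 0
  then show ?case using refinement_terminates[OF run_init] by (simp add: alg_init_def)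
next
  case (Suc k)
  then obtain t s where "S t = Some s" "idx s = k" "accepted f \<phi> s (g t)" by blast
  from run_Suc_accepted[OF this(1,3)] this(2) show ?case
    using refinement_terminates[of "Suc t"] by simp
qed

lemma iterate:
  shows iterate_dom: "x k \<in> eff_dom f"
    and iterate_above: "\<phi> < r (x k)"
    and iterate_subgradient: "y \<in> X \<Longrightarrow> r (x k) + h k \<bullet> (y - x k) \<le> r y"
    and iterate_chosen: "\<exists>t s. S t = Some s \<and> h k = g t"
proof -
  obtain t s where t: "S t = Some s" "idx s = k" "accepted f \<phi> s (g t)"
    using index_accepted by blast
  have xh: "x k = pt s" "h k = g t" using accepted_iterate[OF t(1,3)] t(2) by auto
  show dom: "x k \<in> eff_dom f" using run_dom[OF t(1)] xh by simp
  show "\<phi> < r (x k)" using t(3) ereal_r[OF dom] xh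
    by (metis accepted_def ereal_less_eq(3) not_le)
  show "\<exists>t s. S t = Some s \<and> h k = g t" using t(1) xh by blast
  have "f (x k) + ereal (h k \<bullet> (y - x k)) \<le> f y"
    using run_subgradient[OF t(1)] xh by (simp add: subdifferential_def)
  then show "r (x k) + h k \<bullet> (y - x k) \<le> r y" if "y \<in> X"
    using ereal_r[OF dom] ereal_r[of y] that X_subset_eff_dom
    by (metis ereal_less_eq(3) plus_ereal.simps(1) subsetD)
qed

lemma iterate_Suc: "norm (x (Suc k) - closest_point X (sg_step k)) \<le> eps k"
proof -
  obtain t s where t: "S t = Some s" "idx s = Suc k" "accepted f \<phi> s (g t)"
    using index_accepted by blast
  then show ?thesis
    using accepted_iterate[OF t(1,3)] run_invariant[OF t(1)] by simp
qed

end

section \<open>Descent towards the solution set and its two consequences for the function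
  values\<close>

theorem theorem3:
  fixes f :: "real ^ 'n \<Rightarrow> ereal"
    and X Xstar :: "(real ^ 'n) set"
    and P :: "real \<Rightarrow> real ^ 'n \<Rightarrow> real ^ 'n"
    and fstar \<phi> \<beta> \<gamma> Hlow Hupp :: real
    and lam eps \<nu> fk L epst :: "nat \<Rightarrow> real"
    and x0 :: "real ^ 'n"
    and g x h :: "nat \<Rightarrow> real ^ 'n"
    and S :: "nat \<Rightarrow> (real ^ 'n) alg_state option"
  assumes f_range: "proper_range f"
    and f_convex: "convex_fun f"
    and X_dom: "X \<subset> interior (eff_dom f)"
    and X_closed: "closed X"
    and X_convex: "convex X"
    and Xstar: "Xstar = argmin_on f X"
    and Xstar_nonempty: "Xstar \<noteq> {}"
    and Xstar_bounded: "bounded Xstar"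
    and fstar: "ereal fstar = (INF y\<in>X. f y)"
    and approx_proj: "\<forall>e\<ge>0. \<forall>y. norm (P e y - closest_point X y) \<le> e"
    and \<phi>: "\<phi> < fstar"
    and lam: "\<forall>k. 0 < lam k \<and> lam k \<le> \<beta>"
    and \<beta>: "\<beta> < 2"
    and lam_sum: "filterlim (\<lambda>n. \<Sum>k<n. lam k) at_top sequentially"
    and \<nu>: "\<forall>k. 0 \<le> \<nu> k"
    and \<nu>_sum: "summable \<nu>"
    and \<gamma>: "0 < \<gamma>" "\<gamma> < 1"
    and run: "alg_run f X P \<phi> lam eps \<gamma> x0 g S"
    and iterates: "final_iterates f \<phi> g S x h"
    and fk: "\<forall>k. fk k = real_of_ereal (f (x k))"
    and L: "\<forall>k. L k = lam k * (2 - \<beta>) * (fk k - \<phi>) / (norm (h k))\<^sup>2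
                  * (fstar - fk k + \<beta> / (2 - \<beta>) * (fstar - \<phi>))"
    and epst: "\<forall>k. epst k =
                 - (lam k * (fk k - \<phi>) / norm (h k) + infdist (x k) Xstar)
                 + sqrt ((lam k * (fk k - \<phi>) / norm (h k) + infdist (x k) Xstar)\<^sup>2 - L k)"
    and Hlow: "0 < Hlow"
    and sg_bounds: "\<forall>t s. S t = Some s \<longrightarrow> Hlow \<le> norm (g t) \<and> norm (g t) \<le> Hupp"
    and eps: "\<forall>k. 0 \<le> eps k \<and> eps k \<le> min \<bar>epst k\<bar> (\<nu> k)"
  shows "(\<forall>\<delta>>0. \<exists>K. fk K \<le> fstar + \<beta> / (2 - \<beta>) * (fstar - \<phi>) + \<delta>) \<and>
         (lam \<longlonglongrightarrow> 0 \<longrightarrow> fk \<longlonglongrightarrow> fstar)"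
proof -
  have Xne: "X \<noteq> {}"
    using Xstar_nonempty Xstar by (auto simp: argmin_on_def is_arg_min_def)
  have fstar_le: "ereal fstar \<le> f y" if "y \<in> X" for y
    unfolding fstar using that by (rule INF_lower)
  have h_run: "Hlow \<le> norm (g t)" "norm (g t) \<le> Hupp" if "S t = Some s" for t s
    using sg_bounds that by auto
  interpret subgradient_run f X P \<phi> \<gamma> lam eps x0 g x h S
  proof
    show "X \<subseteq> interior (eff_dom f)" using X_dom by blast
    show "ereal \<phi> < f y" if "y \<in> X" for y
      using \<phi> fstar_le[OF that] by (metis less_ereal.simps(1) less_le_trans)
    show "g t \<noteq> 0" if "S t = Some s" for t s
      using h_run[OF that] Hlow by auto
  qed (use f_range f_convex X_closed X_convex Xne approx_proj eps \<gamma> run iterates in auto)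
  have fk_r: "fk k = r (x k)" for k using fk by simp
  have fstar_le_r: "fstar \<le> r y" if "y \<in> X" for y
    using fstar_le[OF that] ereal_r[of y] that X_subset_eff_dom by (metis ereal_less_eq(3) subsetD)
  \<comment> \<open>The sublevel form is the one \<open>sharp_growth\<close> works with, and it
    makes \<open>Xstar\<close> closed by continuity.\<close>
  have Xstar_eq: "Xstar = {y \<in> X. r y \<le> fstar}"
  proof -
    have "(\<forall>z\<in>X. f y \<le> f z) \<longleftrightarrow> r y \<le> fstar" if "y \<in> X" for y
    proof -
      have "(\<forall>z\<in>X. f y \<le> f z) \<longleftrightarrow> f y \<le> ereal fstar"
        unfolding fstar by (simp add: le_INF_iff)
      also have "\<dots> \<longleftrightarrow> r y \<le> fstar"
        using ereal_r[of y] that X_subset_eff_dom by (metis ereal_less_eq(3) subsetD)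
      finally show ?thesis .
    qed
    then show ?thesis
      unfolding Xstar argmin_on_def is_arg_min_def by (auto simp: not_less)
  qed
  have "closed Xstar"
    using continuous_closed_preimage[OF continuous_on_subset[OF continuous_on_r X_dom] X(1)
        closed_atMost, of fstar] X_dom
    by (simp add: Xstar_eq vimage_def Int_def)
  then have Xstar_compact: "compact Xstar"
    using Xstar_bounded compact_eq_bounded_closed by blast
  have h_bounds: "Hlow \<le> norm (h k)" "norm (h k) \<le> Hupp" for k
    using iterate_chosen[of k] h_run by auto
  have Hupp: "0 < Hupp" using h_bounds[of 0] Hlow by linarith
  have h_pos: "0 < norm (h k)" for k using h_bounds[of k] Hlow by linarith
  have eps_\<nu>: "eps k \<le> \<nu> k" for k using eps by simp
  define d where "d k = infdist (x k) Xstar" for k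
  have d: "0 \<le> d k" for k by (simp add: d_def infdist_nonneg)
  have closest: "\<exists>p\<in>Xstar. d k = dist (x k) p" for k
    unfolding d_def using infdist_attains_inf[OF \<open>closed Xstar\<close> Xstar_nonempty] by metis
  \<comment> \<open>The one-step estimate is applied at the minimizer nearest to \<open>x k\<close>.
    After the step this point need not be nearest any more, but its distance still bounds
    \<open>d (Suc k)\<close> from above.\<close>
  have step: "\<exists>q\<ge>0. q\<^sup>2 \<le> (d k)\<^sup>2 + step_size k * (lam k * (fk k - \<phi>) - 2 * (fk k - fstar))
       \<and> q \<le> d k + lam k * (fk k - \<phi>) / norm (h k) \<and> d (Suc k) \<le> q + \<nu> k" for k
  proof -
    obtain p where p: "p \<in> Xstar" "d k = dist (x k) p" using closest by blast
    then have pX: "p \<in> X" "r p \<le> fstar" by (auto simp: Xstar_eq)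
    have "r (x k) + h k \<bullet> (p - x k) \<le> fstar" using iterate_subgradient[OF pX(1), of k] pX(2) by simp
    then obtain q where "0 \<le> q"
      "q\<^sup>2 \<le> (dist (x k) p)\<^sup>2 + step_size k * (lam k * (r (x k) - \<phi>) - 2 * (r (x k) - fstar))"
      "q \<le> dist (x k) p + lam k * (r (x k) - \<phi>) / norm (h k)" "dist (x (Suc k)) p \<le> q + eps k"
      using projected_subgradient_step[OF X(1,2) pX(1) _ _ _ _ refl iterate_Suc, of k fstar]
        h_pos[of k] iterate_above[of k] lam by (metis less_eq_real_def norm_zero order_less_irrefl)
    moreover have "d (Suc k) \<le> dist (x (Suc k)) p"
      unfolding d_def using p(1) by (rule infdist_le)
    ultimately show ?thesis
      using p(2) eps_\<nu>[of k] unfolding fk_r by (intro exI[of _ q]) auto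
  qed
  \<comment> \<open>This limits the step length near \<open>Xstar\<close>.\<close>
  have value_bound: "fk k - fstar \<le> Hupp * d k" for k
  proof -
    obtain p where p: "p \<in> Xstar" "d k = dist (x k) p" using closest by blast
    then have "fk k - fstar \<le> h k \<bullet> (x k - p)"
      using iterate_subgradient[of p k] unfolding fk_r by (auto simp: Xstar_eq inner_diff_right)
    also have "\<dots> \<le> norm (h k) * norm (x k - p)" by (rule norm_cauchy_schwarz)
    also have "\<dots> \<le> Hupp * d k"
      unfolding p(2) dist_norm using h_bounds by (intro mult_right_mono) auto
    finally show ?thesis .
  qed
  \<comment> \<open>If the bracket is at most \<open>- m\<close>, the decrease is at least
    \<open>m\<close> times the step size, which is bounded below by means of
    \<open>fk k \<ge> fstar\<close> and \<open>norm (h k) \<le> Hupp\<close>.\<close>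
  have decrease: "\<exists>q\<ge>0. q\<^sup>2 \<le> (d k)\<^sup>2 - (m * (fstar - \<phi>) / Hupp\<^sup>2) * lam k \<and> d (Suc k) \<le> q + \<nu> k"
    if "fstar \<le> fk k" "lam k * (fk k - \<phi>) - 2 * (fk k - fstar) \<le> - m" "0 \<le> m" for k m
  proof -
    have "lam k * (fstar - \<phi>) / Hupp\<^sup>2 \<le> step_size k"
      using lam that(1) \<phi> h_bounds[of k] h_pos[of k] unfolding fk_r
      by (intro frac_le mult_left_mono power_mono mult_nonneg_nonneg) (auto intro: less_imp_le)
    then have le: "lam k * (fstar - \<phi>) / Hupp\<^sup>2 * m \<le> step_size k * m"
      using that(3) by (rule mult_right_mono)
    have "0 \<le> step_size k"
      using lam iterate_above[of k] by (simp add: less_imp_le)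
    then have "step_size k * (lam k * (fk k - \<phi>) - 2 * (fk k - fstar)) \<le> step_size k * (- m)"
      using that(2) by (intro mult_left_mono)
    also have "\<dots> = - (step_size k * m)" by (rule mult_minus_right)
    also have "\<dots> \<le> - (lam k * (fstar - \<phi>) / Hupp\<^sup>2 * m)" using le by (rule le_imp_neg_le)
    also have "lam k * (fstar - \<phi>) / Hupp\<^sup>2 * m = (m * (fstar - \<phi>) / Hupp\<^sup>2) * lam k" by simp
    finally have "step_size k * (lam k * (fk k - \<phi>) - 2 * (fk k - fstar))
        \<le> - ((m * (fstar - \<phi>) / Hupp\<^sup>2) * lam k)" .
    with step[of k] show ?thesis by force
  qed
  have lam0: "0 \<le> lam k" for k using lam by (simp add: less_imp_le)
  have \<nu>0: "0 \<le> \<nu> k" for k using \<nu> by simp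
  show ?thesis
  proof (intro conjI allI impI)
    fix \<delta> :: real assume \<delta>: "0 < \<delta>"
    show "\<exists>K. fk K \<le> fstar + \<beta> / (2 - \<beta>) * (fstar - \<phi>) + \<delta>"
    proof (rule ccontr)
      assume "\<not> ?thesis"
      then have large: "fstar + \<beta> / (2 - \<beta>) * (fstar - \<phi>) + \<delta> < fk k" for k
        by (auto simp: not_le)
      \<comment> \<open>With \<open>lam k\<close> replaced by \<open>\<beta>\<close> the bracket
        equals \<open>\<beta> * (fstar - \<phi>) - (2 - \<beta>) * (fk k - fstar)\<close>, and
        \<open>large\<close> puts this below \<open>- (2 - \<beta>) * \<delta>\<close>.\<close>
      define m where "m = (2 - \<beta>) * \<delta>"
      have m: "0 < m" using \<delta> \<beta> by (simp add: m_def)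
      have \<beta>0: "0 < \<beta>" using lam[rule_format, of 0] by linarith
      have "\<exists>q\<ge>0. q\<^sup>2 \<le> (d k)\<^sup>2 - (m * (fstar - \<phi>) / Hupp\<^sup>2) * lam k \<and> d (Suc k) \<le> q + \<nu> k" for k
      proof (rule decrease)
        have "0 \<le> \<beta> / (2 - \<beta>) * (fstar - \<phi>)" using \<beta> \<beta>0 \<phi> by simp
        with large[of k] \<delta> show "fstar \<le> fk k" by linarith
        have "(2 - \<beta>) * (\<beta> / (2 - \<beta>) * (fstar - \<phi>) + \<delta>) \<le> (2 - \<beta>) * (fk k - fstar)"
          using large[of k] \<beta> by (intro mult_left_mono) auto
        then have "\<beta> * (fstar - \<phi>) + m \<le> (2 - \<beta>) * (fk k - fstar)"
          using \<beta> by (simp add: m_def distrib_left)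
        moreover have "lam k * (fk k - \<phi>) \<le> \<beta> * (fk k - \<phi>)"
          using lam iterate_above[of k] unfolding fk_r by (intro mult_right_mono) auto
        ultimately show "lam k * (fk k - \<phi>) - 2 * (fk k - fstar) \<le> - m"
          by (simp add: algebra_simps)
        show "0 \<le> m" using m by simp
      qed
      then show False
        using m \<phi> Hupp by (intro square_descent_diverges[OF d _ lam0 lam_sum \<nu>0 \<nu>_sum,
              of "m * (fstar - \<phi>) / Hupp\<^sup>2"]) auto
    qed
  next
    assume lam_lim: "lam \<longlonglongrightarrow> 0"
    \<comment> \<open>Iterates may be infeasible, but they are within \<open>\<nu> k\<close> of an
      exact projection; \<open>sharp_growth\<close> needs this asymptotic feasibility.\<close>
    have "(\<lambda>k. infdist (x (Suc k)) X) \<longlonglongrightarrow> 0"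
    proof (rule Lim_null_comparison[OF _ summable_LIMSEQ_zero[OF \<nu>_sum]], intro always_eventually allI)
      fix k
      have "infdist (x (Suc k)) X \<le> dist (x (Suc k)) (closest_point X (sg_step k))"
        using X by (intro infdist_le closest_point_in_set)
      then show "norm (infdist (x (Suc k)) X) \<le> \<nu> k"
        using iterate_Suc[of k] eps_\<nu>[of k] by (simp add: dist_norm infdist_nonneg)
    qed
    then have X_lim: "(\<lambda>k. infdist (x k) X) \<longlonglongrightarrow> 0" by (rule LIMSEQ_imp_Suc)
    have scaled: "\<forall>\<^sub>F k in sequentially. lam k * a < b" if "0 < b" for a b :: real
      using tendsto_mult_left_zero[OF lam_lim, of a] that by (rule order_tendstoD)
    have "d \<longlonglongrightarrow> 0"
    proof (rule square_descent_tendsto_zero[OF d lam0 lam_sum \<nu>0 \<nu>_sum])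
      fix \<rho> :: real assume \<rho>: "0 < \<rho>"
      obtain \<eta> where \<eta>: "0 < \<eta>"
        "\<And>w. w \<in> eff_dom f \<Longrightarrow> \<rho> \<le> infdist w Xstar \<Longrightarrow> infdist w X < \<eta> \<Longrightarrow> fstar + \<eta> \<le> r w"
        using sharp_growth[OF convex_on_real_of_ereal[OF f_range f_convex] X(1,2) _ Xstar_eq
            Xstar_nonempty Xstar_bounded \<rho>] X_dom by blast
      have "\<forall>\<^sub>F k in sequentially. infdist (x k) X < \<eta>"
        using X_lim \<eta>(1) by (rule order_tendstoD)
      \<comment> \<open>Splitting \<open>fk k - \<phi>\<close> at \<open>fstar\<close> bounds the
        bracket by \<open>- 3/2 * (fk k - fstar) + \<eta> / 2\<close>, which is at most
        \<open>- \<eta>\<close>.\<close>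
      moreover have "\<forall>\<^sub>F k in sequentially. lam k * 1 < 1 / 2"
        "\<forall>\<^sub>F k in sequentially. lam k * (fstar - \<phi>) < \<eta> / 2"
        using \<eta>(1) by (intro scaled; simp)+
      ultimately have "\<forall>\<^sub>F k in sequentially. \<rho> \<le> d k \<longrightarrow>
          (\<exists>q\<ge>0. q\<^sup>2 \<le> (d k)\<^sup>2 - (\<eta> * (fstar - \<phi>) / Hupp\<^sup>2) * lam k \<and> d (Suc k) \<le> q + \<nu> k)"
      proof eventually_elim
        case (elim k)
        show ?case
        proof (intro impI decrease)
          assume "\<rho> \<le> d k"
          then have gap: "fstar + \<eta> \<le> fk k"
            unfolding fk_r d_def using \<eta>(2) iterate_dom elim(1) by blast
          then show "fstar \<le> fk k" using \<eta>(1) by simp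
          have "lam k * (fk k - fstar) \<le> 1 / 2 * (fk k - fstar)"
            using elim(2) gap \<eta>(1) by (intro mult_right_mono) auto
          with gap elim(3) show "lam k * (fk k - \<phi>) - 2 * (fk k - fstar) \<le> - \<eta>"
            by (simp add: algebra_simps)
        qed (use \<eta>(1) in simp)
      qed
      then show "\<exists>c>0. \<forall>\<^sub>F k in sequentially. \<rho> \<le> d k \<longrightarrow>
          (\<exists>q\<ge>0. q\<^sup>2 \<le> (d k)\<^sup>2 - c * lam k \<and> d (Suc k) \<le> q + \<nu> k)"
        using \<eta>(1) \<phi> Hupp by (intro exI[of _ "\<eta> * (fstar - \<phi>) / Hupp\<^sup>2"]) auto
      \<comment> \<open>For \<open>d k < \<rho>\<close> the left side bounds the step length, by
        \<open>value_bound\<close> and \<open>Hlow\<close>; a step then adds at most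
        \<open>\<rho>\<close> and the error.\<close>
      have "\<forall>\<^sub>F k in sequentially. lam k * ((Hupp * \<rho> + (fstar - \<phi>)) / Hlow) < \<rho>"
        using \<rho> by (rule scaled)
      then show "\<forall>\<^sub>F k in sequentially. d k < \<rho> \<longrightarrow> d (Suc k) \<le> 2 * \<rho> + \<nu> k"
      proof (eventually_elim, intro impI)
        fix k assume small: "lam k * ((Hupp * \<rho> + (fstar - \<phi>)) / Hlow) < \<rho>" and "d k < \<rho>"
        have "Hupp * d k \<le> Hupp * \<rho>" using Hupp \<open>d k < \<rho>\<close> by simp
        then have "fk k - \<phi> \<le> Hupp * \<rho> + (fstar - \<phi>)" using value_bound[of k] by simp
        then have "lam k * (fk k - \<phi>) / norm (h k) \<le> lam k * (Hupp * \<rho> + (fstar - \<phi>)) / Hlow"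
          using lam0 h_bounds Hlow Hupp \<rho> \<phi>
          by (intro frac_le mult_left_mono mult_nonneg_nonneg) auto
        with small \<open>d k < \<rho>\<close> step[of k] show "d (Suc k) \<le> 2 * \<rho> + \<nu> k" by force
      qed
    qed
    \<comment> \<open>On \<open>Xstar\<close> the value is exactly \<open>fstar\<close>: at most by
      the sublevel form, at least by feasibility.\<close>
    then have "(\<lambda>k. r (x k)) \<longlonglongrightarrow> fstar"
      using X_dom fstar_le_r unfolding d_def[abs_def]
      by (intro tendsto_of_infdist_compact[OF continuous_on_r open_interior Xstar_compact
            Xstar_nonempty]) (auto simp: Xstar_eq intro: antisym)
    then show "fk \<longlonglongrightarrow> fstar" by (simp add: fk_r[abs_def])
  qed
qed

end
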